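(* In the steady state of the job-search process on the labor flow network $\mathbf{A}$ with investment probability $v$, separation probability $\lambda$ and hiring policies $\{h_i\}_{i=1}^N$, the average number (per period) of unemployed workers who become employed after being associated to firm $i$ is, for every firm $i$, $$O_i = \varphi\, h_i\, \bar{h}_{\Gamma_i}\, k_i,$$ where $\bar{h}_{\Gamma_i}=\frac{1}{k_i}\sum_j\mathbf{A}_{ij}h_j$ and $$\varphi = \frac{H}{\sum_{i=1}^N h_i \bar{h}_{\Gamma_i} k_i \left[ \frac{1}{\lambda} + \frac{1}{\bar{h}_{\Gamma_i} [1-(1-v)^{k_i}]} \right]}.$$
   Context: There are $N\ge 2$ firms $\{1,\dots,N\}$, the nodes of a labor flow network: a connected, undirected, unweighted graph without self-loops, with symmetric $0/1$ adjacency matrix $\mathbf{A}$. $\Gamma_i=\{j:\mathbf{A}_{ij}=1\}$ is the neighbor set of firm $i$ and $k_i=|\Gamma_i|$ its degree. Parameters: $v\in(0,1]$, $\lambda\in(0,1]$, and a hiring policy $h_i\in(0,1]$ for each firm. There are $H$ workers, acting independently of each other; every worker is at each time either employed at a firm or unemployed and associated to a firm (his or her last employer). Each period: (1) each firm independently receives an investment (is "open") with probability $v$; (2) each employed worker becomes unemployed with probability $\lambda$ and stays associated to the last employer; (3) each unemployed worker associated to $i$ (excluding newly separated ones) picks a firm $j$ uniformly at random from the set $\gamma_i\subseteq\Gamma_i$ of open neighbors of $i$ and becomes employed at $j$ with probability $h_j$; otherwise (including when $\gamma_i=\emptyset$) the worker remains unemployed and associated to $i$. Let $p_i(t)$ be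 the probability that a worker is employed at $i$ in period $t$, and $q_i(t)$ the probability that a worker is unemployed in period $t$ and associated to $i$. With $\Pr_i(\gamma)=v^{|\gamma|}(1-v)^{k_i-|\gamma|}$ for $\gamma\subseteq\Gamma_i$ (the probability that the set of open neighbors of $i$ is $\gamma$), they satisfy $$p_i(t) = (1-\lambda)p_i(t-1) + h_i \sum_{j \in \Gamma_i}q_j(t-1) \sum_{\gamma\subseteq\Gamma_j,\ i\in\gamma} \Pr{}_j(\gamma) \frac{1}{|\gamma|},$$ $$q_i(t) = \lambda p_i(t-1) + q_i(t-1) \left[ \sum_{\emptyset\neq\gamma\subseteq\Gamma_i} \Pr{}_i(\gamma) \frac{1}{|\gamma|} \sum_{j \in \gamma} (1-h_j) + \Pr{}_i(\emptyset) \right].$$ The steady state is the time-invariant solution $(p_i,q_i)_{i=1}^N$ with $\sum_i p_i+\sum_i q_i=1$. The probability that, in a period of the steady state, a given worker is unemployed and associated to $i$ and gets hired is $o_i=q_i\sum_{\emptyset\ne\gamma\subseteq\Gamma_i}\Pr_i(\gamma)\frac{1}{|\gamma|}\sum_{j\in\gamma}h_j$, and $O_i=Ho_i$ is the corresponding expected number of workers. *)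

theory Defs
  imports Complex_Main
begin

text \<open>Firms are the elements of \<open>{1..N}\<close>; values of \<open>A\<close>, \<open>h\<close>, \<open>p\<close>, \<open>q\<close> outside this range are
  irrelevant. The separation probability is written \<open>s\<close>.\<close>

definition labor_flow_network :: "nat \<Rightarrow> (nat \<Rightarrow> nat \<Rightarrow> real) \<Rightarrow> bool" where
  "labor_flow_network N A \<longleftrightarrow>
     2 \<le> N \<and>
     (\<forall>i\<in>{1..N}. \<forall>j\<in>{1..N}. A i j \<in> {0, 1}) \<and>
     (\<forall>i\<in>{1..N}. \<forall>j\<in>{1..N}. A i j = A j i) \<and>
     (\<forall>i\<in>{1..N}. A i i = 0) \<and>
     (\<forall>i\<in>{1..N}. \<forall>j\<in>{1..N}. (i, j) \<in> {(x, y) \<in> {1..N} \<times> {1..N}. A x y = 1}\<^sup>*)"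

definition nbrs :: "nat \<Rightarrow> (nat \<Rightarrow> nat \<Rightarrow> real) \<Rightarrow> nat \<Rightarrow> nat set" where
  "nbrs N A i = {j \<in> {1..N}. A i j = 1}"

definition deg :: "nat \<Rightarrow> (nat \<Rightarrow> nat \<Rightarrow> real) \<Rightarrow> nat \<Rightarrow> nat" where
  "deg N A i = card (nbrs N A i)"

text \<open>Probability that \<open>\<gamma>\<close> is exactly the set of open neighbors of firm \<open>i\<close>; only meant for
  \<open>\<gamma> \<subseteq> nbrs N A i\<close>.\<close>

definition open_prob :: "nat \<Rightarrow> (nat \<Rightarrow> nat \<Rightarrow> real) \<Rightarrow> real \<Rightarrow> nat \<Rightarrow> nat set \<Rightarrow> real" where
  "open_prob N A v i \<gamma> = v ^ card \<gamma> * (1 - v) ^ (deg N A i - card \<gamma>)"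

text \<open>\<open>P t i\<close> is the probability that a worker is employed at \<open>i\<close> in period \<open>t\<close>, and \<open>Q t i\<close> the
  probability that a worker is unemployed in period \<open>t\<close> and associated to \<open>i\<close>.\<close>

definition job_search_dynamics ::
  "nat \<Rightarrow> (nat \<Rightarrow> nat \<Rightarrow> real) \<Rightarrow> real \<Rightarrow> real \<Rightarrow> (nat \<Rightarrow> real) \<Rightarrow>
   (nat \<Rightarrow> nat \<Rightarrow> real) \<Rightarrow> (nat \<Rightarrow> nat \<Rightarrow> real) \<Rightarrow> bool" where
  "job_search_dynamics N A v s h P Q \<longleftrightarrow>
     (\<forall>t. \<forall>i\<in>{1..N}.
        P (Suc t) i = (1 - s) * P t i
          + h i * (\<Sum>j\<in>nbrs N A i. Q t j *
              (\<Sum>\<gamma> | \<gamma> \<subseteq> nbrs N A j \<and> i \<in> \<gamma>. open_prob N A v j \<gamma> * (1 / real (card \<gamma>)))) \<and>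
        Q (Suc t) i = s * P t i
          + Q t i *
              ((\<Sum>\<gamma> | \<gamma> \<subseteq> nbrs N A i \<and> \<gamma> \<noteq> {}.
                  open_prob N A v i \<gamma> * (1 / real (card \<gamma>)) * (\<Sum>j\<in>\<gamma>. 1 - h j))
               + open_prob N A v i {}))"

definition steady_state ::
  "nat \<Rightarrow> (nat \<Rightarrow> nat \<Rightarrow> real) \<Rightarrow> real \<Rightarrow> real \<Rightarrow> (nat \<Rightarrow> real) \<Rightarrow>
   (nat \<Rightarrow> real) \<Rightarrow> (nat \<Rightarrow> real) \<Rightarrow> bool" where
  "steady_state N A v s h p q \<longleftrightarrow>
     job_search_dynamics N A v s h (\<lambda>t. p) (\<lambda>t. q) \<and>
     (\<Sum>i=1..N. p i) + (\<Sum>i=1..N. q i) = 1"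

text \<open>Probability that a given worker is unemployed and associated to \<open>i\<close> and gets hired in a
  period, when \<open>q\<close> gives the probabilities of being unemployed and associated to each firm.\<close>

definition outflow_prob ::
  "nat \<Rightarrow> (nat \<Rightarrow> nat \<Rightarrow> real) \<Rightarrow> real \<Rightarrow> (nat \<Rightarrow> real) \<Rightarrow> (nat \<Rightarrow> real) \<Rightarrow> nat \<Rightarrow> real" where
  "outflow_prob N A v h q i =
     q i * (\<Sum>\<gamma> | \<gamma> \<subseteq> nbrs N A i \<and> \<gamma> \<noteq> {}.
              open_prob N A v i \<gamma> * (1 / real (card \<gamma>)) * (\<Sum>j\<in>\<gamma>. h j))"

definition expected_outflow ::
  "nat \<Rightarrow> nat \<Rightarrow> (nat \<Rightarrow> nat \<Rightarrow> real) \<Rightarrow> real \<Rightarrow> (nat \<Rightarrow> real) \<Rightarrow> (nat \<Rightarrow> real) \<Rightarrow> nat \<Rightarrow> real" where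
  "expected_outflow H N A v h q i = real H * outflow_prob N A v h q i"

definition mean_nbr_hiring :: "nat \<Rightarrow> (nat \<Rightarrow> nat \<Rightarrow> real) \<Rightarrow> (nat \<Rightarrow> real) \<Rightarrow> nat \<Rightarrow> real" where
  "mean_nbr_hiring N A h i = 1 / real (deg N A i) * (\<Sum>j=1..N. A i j * h j)"

definition outflow_factor ::
  "nat \<Rightarrow> nat \<Rightarrow> (nat \<Rightarrow> nat \<Rightarrow> real) \<Rightarrow> real \<Rightarrow> real \<Rightarrow> (nat \<Rightarrow> real) \<Rightarrow> real" where
  "outflow_factor H N A v s h =
     real H / (\<Sum>i=1..N. h i * mean_nbr_hiring N A h i * real (deg N A i) *
                 (1 / s + 1 / (mean_nbr_hiring N A h i * (1 - (1 - v) ^ deg N A i))))"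

end

theory Submission
  imports Defs "HOL-Combinatorics.Transposition"
begin

text \<open>A worker associated to \<open>i\<close> approaches each neighbor of \<open>i\<close> with the same probability
  \<open>c\<^sub>i\<close>, and \<open>deg i * c\<^sub>i = 1 - (1 - v) ^ deg i\<close>. The stationary equation for \<open>q\<close> then says that the
  outflow \<open>o\<^sub>i = q\<^sub>i c\<^sub>i (\<Sum>j\<in>\<Gamma>\<^sub>i. h\<^sub>j)\<close> equals \<open>s p\<^sub>i\<close>. Substituting this into the equation for \<open>p\<close>,
  the ratio \<open>y\<^sub>i = q\<^sub>i c\<^sub>i / h\<^sub>i\<close> satisfies \<open>(\<Sum>j\<in>\<Gamma>\<^sub>i. h\<^sub>j (y\<^sub>i - y\<^sub>j)) = 0\<close>, so by the maximum
  principle it is constant on the connected network. The normalization of the steady state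
  determines the constant.\<close>

text \<open>Exchanging the two sums turns an average over the random open set into a sum over single
  neighbors, each weighted by the sets that contain it.\<close>

lemma sum_nonempty_subsets_swap:
  fixes f :: "'a set \<Rightarrow> 'b::comm_semiring_0" and g :: "'a \<Rightarrow> 'b"
  assumes "finite S"
  shows "(\<Sum>\<gamma> | \<gamma> \<subseteq> S \<and> \<gamma> \<noteq> {}. f \<gamma> * (\<Sum>j\<in>\<gamma>. g j)) =
    (\<Sum>j\<in>S. g j * (\<Sum>\<gamma> | \<gamma> \<subseteq> S \<and> j \<in> \<gamma>. f \<gamma>))"
proof -
  let ?N = "{\<gamma>. \<gamma> \<subseteq> S \<and> \<gamma> \<noteq> {}}"
  have "(\<Sum>\<gamma>\<in>?N. f \<gamma> * (\<Sum>j\<in>\<gamma>. g j)) = (\<Sum>\<gamma>\<in>?N. \<Sum>j | j \<in> S \<and> j \<in> \<gamma>. g j * f \<gamma>)"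
    by (intro sum.cong refl) (auto simp: sum_distrib_left mult.commute intro!: sum.cong)
  also have "\<dots> = (\<Sum>j\<in>S. \<Sum>\<gamma> | \<gamma> \<in> ?N \<and> j \<in> \<gamma>. g j * f \<gamma>)"
    using assms by (intro sum.swap_restrict) auto
  also have "\<dots> = (\<Sum>j\<in>S. g j * (\<Sum>\<gamma> | \<gamma> \<subseteq> S \<and> j \<in> \<gamma>. f \<gamma>))"
    by (auto simp: sum_distrib_left intro!: sum.cong)
  finally show ?thesis .
qed

lemma sum_binomial_weights:
  fixes v :: "'a::comm_ring_1"
  assumes "finite S"
  shows "(\<Sum>\<gamma>\<in>Pow S. v ^ card \<gamma> * (1 - v) ^ (card S - card \<gamma>)) = 1"
  using assms
proof (induction S rule: finite_induct)
  case (insert x S)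
  have inj: "inj_on (insert x) (Pow S)"
    using insert.hyps by (auto simp: inj_on_def)
  have card_le: "card \<gamma> \<le> card S" if "\<gamma> \<in> Pow S" for \<gamma>
    using that insert.hyps by (auto intro: card_mono)
  have card_ins: "card (insert x \<gamma>) = Suc (card \<gamma>)" if "\<gamma> \<in> Pow S" for \<gamma>
    using that insert.hyps by (auto intro!: card_insert_disjoint intro: finite_subset)
  let ?w = "\<lambda>\<gamma>. v ^ card \<gamma> * (1 - v) ^ (card (insert x S) - card \<gamma>)"
  let ?u = "\<lambda>\<gamma>. v ^ card \<gamma> * (1 - v) ^ (card S - card \<gamma>)"
  \<comment> \<open>The subsets are split by membership of \<open>x\<close>: those with
    \<open>x\<close> gain a factor \<open>v\<close>, those without it a factor \<open>1 - v\<close>,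
    and these factors add up to 1.\<close>
  have "(\<Sum>\<gamma>\<in>Pow (insert x S). ?w \<gamma>) = (\<Sum>\<gamma>\<in>Pow S. ?w \<gamma>) + (\<Sum>\<gamma>\<in>insert x ` Pow S. ?w \<gamma>)"
    unfolding Pow_insert using insert.hyps by (intro sum.union_disjoint) auto
  also have "(\<Sum>\<gamma>\<in>insert x ` Pow S. ?w \<gamma>) = (\<Sum>\<gamma>\<in>Pow S. v * ?u \<gamma>)"
    using insert.hyps by (subst sum.reindex[OF inj]) (auto simp: card_ins intro!: sum.cong)
  also have "(\<Sum>\<gamma>\<in>Pow S. ?w \<gamma>) = (\<Sum>\<gamma>\<in>Pow S. (1 - v) * ?u \<gamma>)"
    using insert.hyps by (intro sum.cong) (auto simp: Suc_diff_le card_le mult_ac)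
  finally show ?case
    using insert.IH by (simp flip: sum_distrib_left)
qed auto

text \<open>Transposing \<open>a\<close> and \<open>b\<close> is a cardinality-preserving involution
  that exchanges the two families of subsets.\<close>

lemma sum_card_invariant_containing:
  assumes "a \<in> S" "b \<in> S"
  shows "(\<Sum>\<gamma> | \<gamma> \<subseteq> S \<and> a \<in> \<gamma>. f (card \<gamma>)) = (\<Sum>\<gamma> | \<gamma> \<subseteq> S \<and> b \<in> \<gamma>. f (card \<gamma>))"
proof (rule sum.reindex_bij_witness[of _ "image (transpose a b)" "image (transpose a b)"])
  have sub: "transpose a b ` \<gamma> \<subseteq> S" if "\<gamma> \<subseteq> S" for \<gamma>
    using that assms by (auto simp: transpose_def)
  fix \<gamma> assume "\<gamma> \<in> {\<gamma>. \<gamma> \<subseteq> S \<and> a \<in> \<gamma>}"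
  then show "transpose a b ` \<gamma> \<in> {\<gamma>. \<gamma> \<subseteq> S \<and> b \<in> \<gamma>}"
    using sub by (auto intro: image_eqI[of _ _ a])
next
  have sub: "transpose a b ` \<gamma> \<subseteq> S" if "\<gamma> \<subseteq> S" for \<gamma>
    using that assms by (auto simp: transpose_def)
  fix \<gamma> assume "\<gamma> \<in> {\<gamma>. \<gamma> \<subseteq> S \<and> b \<in> \<gamma>}"
  then show "transpose a b ` \<gamma> \<in> {\<gamma>. \<gamma> \<subseteq> S \<and> a \<in> \<gamma>}"
    using sub by (auto intro: image_eqI[of _ _ b])
qed (auto simp: image_image card_image)

lemma finite_nbrs [simp]: "finite (nbrs N A i)"
  by (simp add: nbrs_def)

lemma sum_open_prob_nonempty:
  "(\<Sum>\<gamma> | \<gamma> \<subseteq> nbrs N A i \<and> \<gamma> \<noteq> {}. open_prob N A v i \<gamma>) = 1 - (1 - v) ^ deg N A i"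
proof -
  have "1 = (\<Sum>\<gamma>\<in>Pow (nbrs N A i). open_prob N A v i \<gamma>)"
    by (simp add: open_prob_def deg_def sum_binomial_weights)
  also have "\<dots> = open_prob N A v i {} + (\<Sum>\<gamma>\<in>Pow (nbrs N A i) - {{}}. open_prob N A v i \<gamma>)"
    by (intro sum.remove) auto
  also have "Pow (nbrs N A i) - {{}} = {\<gamma>. \<gamma> \<subseteq> nbrs N A i \<and> \<gamma> \<noteq> {}}"
    by auto
  finally show ?thesis
    by (simp add: open_prob_def)
qed

text \<open>Symmetry and double counting: each of the \<open>deg N A i\<close> neighbors receives an equal share of the
  probability that at least one neighbor is open.\<close>

lemma sum_open_prob_containing:
  assumes "j \<in> nbrs N A i"
  shows "(\<Sum>\<gamma> | \<gamma> \<subseteq> nbrs N A i \<and> j \<in> \<gamma>. open_prob N A v i \<gamma> * (1 / real (card \<gamma>))) =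
    (1 - (1 - v) ^ deg N A i) / real (deg N A i)"
proof -
  let ?S = "nbrs N A i"
  let ?w = "\<lambda>\<gamma>. open_prob N A v i \<gamma> * (1 / real (card \<gamma>))"
  have fin: "finite \<gamma>" if "\<gamma> \<subseteq> ?S" for \<gamma>
    using that finite_nbrs finite_subset by blast
  \<comment> \<open>A factor \<open>card \<gamma> / card \<gamma>\<close> is inserted, its numerator
    written as a sum of ones so that the swap applies.\<close>
  have "1 - (1 - v) ^ deg N A i = (\<Sum>\<gamma> | \<gamma> \<subseteq> ?S \<and> \<gamma> \<noteq> {}. ?w \<gamma> * (\<Sum>l\<in>\<gamma>. 1))"
    unfolding sum_open_prob_nonempty[symmetric] by (intro sum.cong) (auto dest: fin)
  also have "\<dots> = (\<Sum>l\<in>?S. \<Sum>\<gamma> | \<gamma> \<subseteq> ?S \<and> l \<in> \<gamma>. ?w \<gamma>)"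
    by (subst sum_nonempty_subsets_swap) simp_all
  \<comment> \<open>The weight depends on \<open>\<gamma>\<close> only through its cardinality, so
    \<open>l\<close> may be replaced by the fixed neighbor \<open>j\<close>.\<close>
  also have "\<dots> = (\<Sum>l\<in>?S. \<Sum>\<gamma> | \<gamma> \<subseteq> ?S \<and> j \<in> \<gamma>. ?w \<gamma>)"
    unfolding open_prob_def by (intro sum.cong refl sum_card_invariant_containing assms)
  also have "\<dots> = real (deg N A i) * (\<Sum>\<gamma> | \<gamma> \<subseteq> ?S \<and> j \<in> \<gamma>. ?w \<gamma>)"
    by (simp add: deg_def)
  finally have "1 - (1 - v) ^ deg N A i = \<dots>" .
  moreover have "deg N A i \<noteq> 0"
    using assms by (auto simp: deg_def)
  ultimately show ?thesis
    by simp
qed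

text \<open>Serves twice: \<open>g = h\<close> gives the probability of being hired,
  \<open>g = 1 - h\<close> that of being turned down.\<close>

lemma sum_open_prob_mean:
  "(\<Sum>\<gamma> | \<gamma> \<subseteq> nbrs N A i \<and> \<gamma> \<noteq> {}.
      open_prob N A v i \<gamma> * (1 / real (card \<gamma>)) * (\<Sum>j\<in>\<gamma>. g j)) =
    (\<Sum>j\<in>nbrs N A i. g j) * ((1 - (1 - v) ^ deg N A i) / real (deg N A i))"
  unfolding sum_nonempty_subsets_swap[OF finite_nbrs] sum_distrib_right
  by (intro sum.cong refl) (simp only: sum_open_prob_containing)

text \<open>As there are at least two firms, some path leads from \<open>i\<close> to another firm,
  and its first edge gives a neighbor.\<close>

lemma deg_pos:
  assumes "labor_flow_network N A" "i \<in> {1..N}"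
  shows "0 < deg N A i"
proof -
  obtain j where j: "j \<in> {1..N}" "j \<noteq> i"
  proof (cases "i = 1")
    case True
    then show ?thesis using that[of 2] assms by (auto simp: labor_flow_network_def)
  next
    case False
    then show ?thesis using that[of 1] assms by (auto simp: labor_flow_network_def)
  qed
  then have "(i, j) \<in> {(x, y) \<in> {1..N} \<times> {1..N}. A x y = 1}\<^sup>*"
    using assms unfolding labor_flow_network_def by blast
  then have "nbrs N A i \<noteq> {}"
    using j by (cases rule: converse_rtranclE) (auto simp: nbrs_def)
  then show ?thesis
    by (simp add: deg_def card_gt_0_iff)
qed

lemma sum_adjacency:
  assumes "labor_flow_network N A" "i \<in> {1..N}"
  shows "(\<Sum>j=1..N. A i j * g j) = (\<Sum>j\<in>nbrs N A i. g j)"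
proof -
  have "(\<Sum>j=1..N. A i j * g j) = (\<Sum>j=1..N. if A i j = 1 then g j else 0)"
    using assms by (intro sum.cong) (force simp: labor_flow_network_def)+
  then show ?thesis
    by (simp add: nbrs_def sum.If_cases Int_def)
qed

text \<open>Maximum principle: the set of maximizers of \<open>y\<close> is closed under taking neighbors.\<close>

lemma harmonic_imp_constant:
  fixes y w :: "nat \<Rightarrow> real"
  assumes net: "labor_flow_network N A"
    and w: "\<And>i. i \<in> {1..N} \<Longrightarrow> 0 < w i"
    and harmonic: "\<And>i. i \<in> {1..N} \<Longrightarrow> (\<Sum>j\<in>nbrs N A i. w j * (y i - y j)) = 0"
  obtains c where "\<And>i. i \<in> {1..N} \<Longrightarrow> y i = c"
proof -
  have "{1..N} \<noteq> {}"
    using net by (auto simp: labor_flow_network_def)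
  then obtain m where m: "m \<in> {1..N}" "\<And>i. i \<in> {1..N} \<Longrightarrow> y i \<le> y m"
    using Max_in[of "y ` {1..N}"] Max_ge[of "y ` {1..N}"] by fastforce
  have "y i = y m" if "i \<in> {1..N}" for i
  proof -
    have "(m, i) \<in> {(x, y) \<in> {1..N} \<times> {1..N}. A x y = 1}\<^sup>*"
      using net m that unfolding labor_flow_network_def by blast
    then show ?thesis
    proof (induction rule: rtrancl_induct)
      case (step a b)
      then have ab: "a \<in> {1..N}" "b \<in> nbrs N A a"
        by (auto simp: nbrs_def)
      have N: "j \<in> {1..N}" if "j \<in> nbrs N A a" for j
        using that by (auto simp: nbrs_def)
      \<comment> \<open>At a maximizer \<open>a\<close> no summand is negative, so a vanishing sum
        makes each of them vanish.\<close>
      have "\<forall>j\<in>nbrs N A a. w j * (y a - y j) = 0"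
        using harmonic[OF ab(1)] less_imp_le[OF w[OF N]] m(2)[OF N] step.IH
        by (subst (asm) sum_nonneg_eq_0_iff) auto
      then show ?case
        using ab(2) w[OF N[OF ab(2)]] step.IH by auto
    qed simp
  qed
  then show thesis by (rule that)
qed

theorem proposition7:
  fixes N H :: nat and A :: "nat \<Rightarrow> nat \<Rightarrow> real" and v s :: real and h p q :: "nat \<Rightarrow> real"
  assumes "labor_flow_network N A"
    and "0 < v" and "v \<le> 1"
    and "0 < s" and "s \<le> 1"
    and "\<forall>i\<in>{1..N}. 0 < h i \<and> h i \<le> 1"
    and "steady_state N A v s h p q"
  shows "\<forall>i\<in>{1..N}. expected_outflow H N A v h q i =
           outflow_factor H N A v s h * h i * mean_nbr_hiring N A h i * real (deg N A i)"
proof -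
  note net = assms(1)
  define k where "k i = real (deg N A i)" for i
  define r where "r i = 1 - (1 - v) ^ deg N A i" for i
  define S where "S i = (\<Sum>j\<in>nbrs N A i. h j)" for i
  define y where "y i = q i * (r i / k i) / h i" for i
  have h: "0 < h i" if "i \<in> {1..N}" for i
    using assms(6) that by blast
  have k: "0 < k i" if "i \<in> {1..N}" for i
    using deg_pos[OF net that] by (simp add: k_def)
  have r: "0 < r i" if "i \<in> {1..N}" for i
    using deg_pos[OF net that] assms(2,3)
    by (simp add: r_def power_less_one_iff)
  have nbr: "j \<in> {1..N}" if "j \<in> nbrs N A i" for i j
    using that by (auto simp: nbrs_def)
  have S: "0 < S i" if "i \<in> {1..N}" for i
    using deg_pos[OF net that] unfolding S_def deg_def
    by (intro sum_pos) (auto simp: card_gt_0_iff dest: nbr h)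
  have mean: "mean_nbr_hiring N A h i = S i / k i" if "i \<in> {1..N}" for i
    using sum_adjacency[OF net that, of h] by (simp add: mean_nbr_hiring_def S_def k_def)

  have flow: "outflow_prob N A v h q i = y i * h i * S i" if "i \<in> {1..N}" for i
    unfolding outflow_prob_def sum_open_prob_mean
    using h[OF that] by (simp add: y_def r_def k_def S_def)
  have p: "s * p i = h i * (\<Sum>j\<in>nbrs N A i. h j * y j)" if "i \<in> {1..N}" for i
  proof -
    have "(\<Sum>j\<in>nbrs N A i. q j * (\<Sum>\<gamma> | \<gamma> \<subseteq> nbrs N A j \<and> i \<in> \<gamma>.
        open_prob N A v j \<gamma> * (1 / real (card \<gamma>)))) = (\<Sum>j\<in>nbrs N A i. h j * y j)"
    proof (rule sum.cong[OF refl])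
      fix j assume j: "j \<in> nbrs N A i"
      \<comment> \<open>By symmetry of \<open>A\<close>, firm \<open>i\<close> is one of the
        neighbors that workers at \<open>j\<close> approach with probability
        \<open>r j / k j\<close>.\<close>
      then have "i \<in> nbrs N A j"
        using net that by (simp add: nbrs_def labor_flow_network_def)
      then show "q j * (\<Sum>\<gamma> | \<gamma> \<subseteq> nbrs N A j \<and> i \<in> \<gamma>.
          open_prob N A v j \<gamma> * (1 / real (card \<gamma>))) = h j * y j"
        using h[OF nbr[OF j]] sum_open_prob_containing[of i N A j v]
        by (simp add: y_def r_def k_def)
    qed
    moreover have "p i = (1 - s) * p i + h i * (\<Sum>j\<in>nbrs N A i. q j *
        (\<Sum>\<gamma> | \<gamma> \<subseteq> nbrs N A j \<and> i \<in> \<gamma>. open_prob N A v j \<gamma> * (1 / real (card \<gamma>))))"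
      using assms(7) that unfolding steady_state_def job_search_dynamics_def by blast
    ultimately show ?thesis
      by (simp add: algebra_simps)
  qed
  have p': "s * p i = y i * h i * S i" if "i \<in> {1..N}" for i
  proof -
    have "q i = s * p i + q i * ((\<Sum>\<gamma> | \<gamma> \<subseteq> nbrs N A i \<and> \<gamma> \<noteq> {}.
        open_prob N A v i \<gamma> * (1 / real (card \<gamma>)) * (\<Sum>j\<in>\<gamma>. 1 - h j)) + open_prob N A v i {})"
      using assms(7) that unfolding steady_state_def job_search_dynamics_def by blast
    moreover have "(\<Sum>j\<in>nbrs N A i. 1 - h j) = k i - S i"
      by (simp add: sum_subtractf k_def S_def deg_def)
    moreover have "open_prob N A v i {} = 1 - r i"
      by (simp add: open_prob_def r_def)
    ultimately have "q i = s * p i + q i * ((k i - S i) * (r i / k i) + (1 - r i))"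
      unfolding sum_open_prob_mean by (simp add: r_def k_def)
    \<comment> \<open>The factor of \<open>q i\<close> on the right is
      \<open>1 - S i * r i / k i\<close>, so \<open>q i\<close> itself cancels.\<close>
    then have "s * p i = q i * (r i / k i) * S i"
      using k[OF that] by (simp add: field_simps)
    then show ?thesis
      using h[OF that] by (simp add: y_def)
  qed

  have "(\<Sum>j\<in>nbrs N A i. h j * (y i - y j)) = 0" if "i \<in> {1..N}" for i
  proof -
    \<comment> \<open>Both sides equal \<open>s * p i\<close>: the left by the equation for
      \<open>q\<close>, the right by the equation for \<open>p\<close>.\<close>
    have "h i * (S i * y i) = h i * (\<Sum>j\<in>nbrs N A i. h j * y j)"
      using p[OF that] p'[OF that] by (simp add: mult_ac)
    then have "S i * y i = (\<Sum>j\<in>nbrs N A i. h j * y j)"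
      using h[OF that] by simp
    then show ?thesis
      by (simp add: S_def right_diff_distrib sum_subtractf flip: sum_distrib_right)
  qed
  then obtain c where c: "\<And>i. i \<in> {1..N} \<Longrightarrow> y i = c"
    using harmonic_imp_constant[of N A h y, OF net h] by blast

  \<comment> \<open>Multiplied by \<open>c\<close>, the \<open>1 / s\<close> part of each summand is
    \<open>p i\<close> and the other part is \<open>q i\<close>.\<close>
  define D where "D = (\<Sum>i=1..N. h i * mean_nbr_hiring N A h i * k i *
      (1 / s + 1 / (mean_nbr_hiring N A h i * r i)))"
  have "1 = (\<Sum>i=1..N. p i + q i)"
    using assms(7) by (simp add: steady_state_def sum.distrib)
  also have "\<dots> = c * D"
    unfolding D_def sum_distrib_left
  proof (rule sum.cong[OF refl])
    fix i assume i: "i \<in> {1..N}"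
    have pi: "p i = c * h i * S i / s"
      using p'[OF i] c[OF i] assms(4) by (simp add: field_simps)
    have qi: "q i = c * h i * k i / r i"
      using c[OF i] k[OF i] r[OF i] h[OF i] by (simp add: y_def field_simps)
    show "p i + q i = c * (h i * mean_nbr_hiring N A h i * k i *
        (1 / s + 1 / (mean_nbr_hiring N A h i * r i)))"
      unfolding pi qi mean[OF i] using k[OF i] r[OF i] S[OF i] assms(4)
      by (simp add: field_simps)
  qed
  \<comment> \<open>Here \<open>D\<close> is nonzero because \<open>c * D = 1\<close>.\<close>
  finally have "1 / D = c"
    by (metis mult_zero_right nonzero_eq_divide_eq zero_neq_one)
  then have factor: "outflow_factor H N A v s h = real H * c"
    by (auto simp: outflow_factor_def D_def k_def r_def)
  show ?thesis
  proof
    fix i assume i: "i \<in> {1..N}"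
    show "expected_outflow H N A v h q i =
        outflow_factor H N A v s h * h i * mean_nbr_hiring N A h i * real (deg N A i)"
      using k[OF i] unfolding expected_outflow_def factor flow[OF i] mean[OF i] c[OF i]
      by (simp add: k_def)
  qed
qed

end
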